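(* Let $\mathbb{K}$ be $\mathbb{R}$ or $\mathbb{C}$, and let $X$ be a topological exponential vector space over $\mathbb{K}$ with additive identity $\theta$. A set $B\subseteq X$ is bounded if and only if for every balanced neighbourhood $U$ of $\theta$ there exists a real number $\alpha>0$ such that $B\subseteq\alpha U$.
   Context: An exponential vector space (evs) over a field $K$ is a partially ordered set $(X,\leq)$ with a binary operation $+$ on $X$ and a scalar multiplication $\cdot:K\times X\to X$ such that for all $x,y,z\in X$, $\alpha,\beta\in K$: ($A_1$) $(X,+)$ is a commutative semigroup with identity $\theta$; ($A_2$) $x\leq y$ implies $x+z\leq y+z$ and $\alpha\cdot x\leq\alpha\cdot y$; ($A_3$) $\alpha\cdot(x+y)=\alpha\cdot x+\alpha\cdot y$, $\alpha\cdot(\beta\cdot x)=(\alpha\beta)\cdot x$, $(\alpha+\beta)\cdot x\leq\alpha\cdot x+\beta\cdot x$, $1\cdot x=x$; ($A_4$) $\alpha\cdot x=\theta$ iff $\alpha=0$ or $x=\theta$; ($A_5$) $x+(-1)\cdot x=\theta$ iff $x\in X_0:=\{z\in X: y\nleq z\ \forall y\in X\smallsetminus\{z\}\}$ (the set of minimal elements); ($A_6$) for each $x\in X$ there is $p\in X_0$ with $p\leq x$. A topological evs over $\mathbb{K}$ ($=\mathbb{R}$ or $\mathbb{C}$, usual topology) is an evs $X$ over $\mathbb{K}$ with a topology such that addition $X\times X\to X$ and scalar multiplication $\mathbb{K}\times X\to X$ are continuous and the partial order is closed, i.e. $\{(x,y)\in X\times X:x\leq y\}$ is closed in $X\times X$.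 For $A\subseteq X$ and $\mu\in\mathbb{K}$, $\mu A=\{\mu a:a\in A\}$. A set $A\subseteq X$ is balanced if $\alpha A\subseteq A$ for all $\alpha\in\mathbb{K}$ with $|\alpha|\leq1$. A subset $A$ of a topological evs $X$ is bounded if for every neighbourhood $V$ of $\theta$ there is a real $\alpha>0$ such that $\mu A\subseteq V$ for all $\mu\in\mathbb{K}$ with $|\mu|\leq\alpha$. Neighbourhoods need not be open. *)

theory Defs
  imports "HOL-Analysis.Analysis"
begin

text \<open>
  Following the library's treatment of modules, the space is a type and the scalar
  multiplication is a locale parameter.  The class \<^class>\<open>ordered_comm_monoid_add\<close> supplies
  the partial order, the commutative monoid structure (the identity is \<open>0\<close>) and the monotonicity
  of addition.
\<close>

definition minimal_elements :: "'a::order set" where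
  "minimal_elements = {z. \<forall>y \<in> UNIV - {z}. \<not> y \<le> z}"

locale evs =
  fixes smul :: "'k::field \<Rightarrow> 'a::ordered_comm_monoid_add \<Rightarrow> 'a"
  assumes smul_mono: "x \<le> y \<Longrightarrow> smul \<alpha> x \<le> smul \<alpha> y"
    and smul_add: "smul \<alpha> (x + y) = smul \<alpha> x + smul \<alpha> y"
    and smul_smul: "smul \<alpha> (smul \<beta> x) = smul (\<alpha> * \<beta>) x"
    and add_smul_le: "smul (\<alpha> + \<beta>) x \<le> smul \<alpha> x + smul \<beta> x"
    and smul_one: "smul 1 x = x"
    and smul_eq_zero_iff: "smul \<alpha> x = 0 \<longleftrightarrow> \<alpha> = 0 \<or> x = 0"
    and add_neg_eq_zero_iff: "x + smul (- 1) x = 0 \<longleftrightarrow> x \<in> minimal_elements"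
    and minimal_below: "\<exists>p \<in> minimal_elements. p \<le> x"

text \<open>
  Continuity of addition is part of \<^class>\<open>topological_comm_monoid_add\<close>.  The scalars are
  intended to be \<^typ>\<open>real\<close> or \<^typ>\<open>complex\<close>; the class \<^class>\<open>real_normed_field\<close> merely
  allows both cases to share the definitions.
\<close>

locale topological_evs = evs smul
  for smul :: "'k::real_normed_field \<Rightarrow>
                'a::{ordered_comm_monoid_add, topological_comm_monoid_add} \<Rightarrow> 'a" +
  assumes continuous_smul: "continuous_on UNIV (\<lambda>(\<alpha>, x). smul \<alpha> x)"
    and closed_order: "closed {(x, y :: 'a). x \<le> y}"

definition neighbourhood :: "'a::topological_space \<Rightarrow> 'a set \<Rightarrow> bool" where
  "neighbourhood x V \<longleftrightarrow> (\<exists>S. open S \<and> x \<in> S \<and> S \<subseteq> V)"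

definition balanced :: "('k::real_normed_field \<Rightarrow> 'a \<Rightarrow> 'a) \<Rightarrow> 'a set \<Rightarrow> bool" where
  "balanced smul A \<longleftrightarrow> (\<forall>\<alpha>. norm \<alpha> \<le> 1 \<longrightarrow> smul \<alpha> ` A \<subseteq> A)"

definition evs_bounded ::
    "('k::real_normed_field \<Rightarrow> 'a::{topological_space, zero} \<Rightarrow> 'a) \<Rightarrow> 'a set \<Rightarrow> bool" where
  "evs_bounded smul A \<longleftrightarrow>
    (\<forall>V. neighbourhood 0 V \<longrightarrow>
      (\<exists>\<alpha>::real. \<alpha> > 0 \<and> (\<forall>\<mu>. norm \<mu> \<le> \<alpha> \<longrightarrow> smul \<mu> ` A \<subseteq> V)))"

end

theory Submission
  imports Defs
begin

text \<open>
  Nonzero scalars act invertibly, so \<open>B \<subseteq> \<alpha> U\<close> says \<open>\<alpha>\<inverse> B \<subseteq> U\<close>.  Hence boundedness of \<open>B\<close>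
  yields the inclusion at once.  The converse rests on the fact that every neighbourhood \<open>V\<close> of \<open>0\<close>
  contains a balanced one (\<open>neighbourhood_balanced_core\<close>): if \<open>U \<subseteq> V\<close> is balanced and
  \<open>B \<subseteq> \<alpha> U\<close>, then \<open>\<mu> B \<subseteq> (\<mu> \<alpha>) U \<subseteq> U \<subseteq> V\<close> as soon as \<open>\<bar>\<mu>\<bar> \<le> \<alpha>\<inverse>\<close>.  As in ordinary topological
  vector spaces, the balanced neighbourhood comes from continuity of the scalar multiplication
  at \<open>(0, 0)\<close> and the rescaling of neighbourhoods by nonzero scalars.  The argument is the same for
  real and complex scalars.
\<close>

text \<open>For a scalar multiplication as above, this is the largest balanced subset of \<open>V\<close>.\<close>

definition balanced_core :: "('k::real_normed_field \<Rightarrow> 'a \<Rightarrow> 'a) \<Rightarrow> 'a set \<Rightarrow> 'a set" where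
  "balanced_core smul V = {x. \<forall>\<mu>. norm \<mu> \<le> 1 \<longrightarrow> smul \<mu> x \<in> V}"

context topological_evs
begin

lemma balanced_balanced_core: "balanced smul (balanced_core smul V)"
  by (auto simp: balanced_def balanced_core_def smul_smul norm_mult mult_le_one)

lemma continuous_on_smul: "continuous_on UNIV (smul \<alpha>)"
  using continuous_on_compose2[OF continuous_smul, of UNIV "\<lambda>x. (\<alpha>, x)"]
  by (simp add: continuous_on_Pair continuous_on_const continuous_on_id)

text \<open>
  Continuity at \<open>(0, 0)\<close> gives an open \<open>W\<close> around \<open>0\<close> and \<open>\<delta> > 0\<close> such that scalars smaller than \<open>\<delta>\<close>
  send \<open>W\<close> into \<open>V\<close>.  With \<open>c = \<delta> / 2\<close>, the balanced core of \<open>V\<close> contains \<open>c W\<close>, which is open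
  because it is the preimage of \<open>W\<close> under multiplication by \<open>c\<inverse>\<close>.
\<close>

lemma neighbourhood_balanced_core:
  assumes "neighbourhood 0 V"
  shows "neighbourhood 0 (balanced_core smul V)"
proof -
  obtain S where S: "open S" "0 \<in> S" "S \<subseteq> V"
    using assms by (auto simp: neighbourhood_def)
  have "open ((\<lambda>(\<alpha>, x). smul \<alpha> x) -` S)"
    using continuous_smul S(1) by (simp add: open_vimage)
  moreover have "(0, 0) \<in> (\<lambda>(\<alpha>, x). smul \<alpha> x) -` S"
    using S(2) smul_eq_zero_iff[of 0 0] by simp
  ultimately obtain D W where DW: "open D" "0 \<in> D" "open W" "0 \<in> W"
      "D \<times> W \<subseteq> (\<lambda>(\<alpha>, x). smul \<alpha> x) -` S"
    by (auto elim!: open_prod_elim)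
  then obtain \<delta> where \<delta>: "\<delta> > 0" "ball 0 \<delta> \<subseteq> D"
    by (meson openE)
  define c :: 'k where "c = of_real (\<delta> / 2)"
  have c: "c \<noteq> 0" "norm c < \<delta>"
    using \<delta>(1) by (simp_all add: c_def del: of_real_divide)
  have "smul (inverse c) -` W \<subseteq> balanced_core smul V"
  proof (clarsimp simp: balanced_core_def)
    fix x \<mu>
    assume x: "smul (inverse c) x \<in> W" and \<mu>: "norm (\<mu> :: 'k) \<le> 1"
    have "norm (\<mu> * c) < \<delta>"
      using \<mu> c(2) mult_right_mono[of "norm \<mu>" 1 "norm c"] by (simp add: norm_mult)
    then have "\<mu> * c \<in> D"
      using \<delta>(2) by auto
    then have "smul (\<mu> * c) (smul (inverse c) x) \<in> V"
      using x DW(5) S(3) by auto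
    then show "smul \<mu> x \<in> V"
      using c(1) by (simp add: smul_smul mult.assoc)
  qed
  moreover have "open (smul (inverse c) -` W)"
    using continuous_on_smul DW(3) by (simp add: open_vimage)
  moreover have "0 \<in> smul (inverse c) -` W"
    using DW(4) smul_eq_zero_iff[of "inverse c" 0] by simp
  ultimately show ?thesis
    unfolding neighbourhood_def by blast
qed

theorem evs_bounded_iff_absorbed:
  "evs_bounded smul B \<longleftrightarrow>
    (\<forall>U. neighbourhood 0 U \<and> balanced smul U \<longrightarrow>
      (\<exists>\<alpha>::real. \<alpha> > 0 \<and> B \<subseteq> smul (of_real \<alpha>) ` U))" (is "_ \<longleftrightarrow> ?absorbed")
proof
  assume bounded: "evs_bounded smul B"
  show ?absorbed
  proof (intro allI impI)
    fix U
    assume "neighbourhood 0 U \<and> balanced smul U"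
    then obtain r :: real where r: "r > 0" "\<And>\<mu>. norm \<mu> \<le> r \<Longrightarrow> smul \<mu> ` B \<subseteq> U"
      using bounded unfolding evs_bounded_def by blast
    have "smul (of_real r) ` B \<subseteq> U"
      using r by simp
    moreover have "smul (of_real (inverse r)) (smul (of_real r) x) = x" for x
      using r(1) by (simp add: smul_smul smul_one)
    ultimately have "B \<subseteq> smul (of_real (inverse r)) ` U"
      by (metis image_eqI image_subset_iff subsetI)
    then show "\<exists>\<alpha>::real. \<alpha> > 0 \<and> B \<subseteq> smul (of_real \<alpha>) ` U"
      using r(1) positive_imp_inverse_positive by blast
  qed
next
  assume absorbed: ?absorbed
  show "evs_bounded smul B"
    unfolding evs_bounded_def
  proof (intro allI impI)
    fix V :: "'a set"
    assume "neighbourhood 0 V"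
    then obtain \<alpha> :: real where \<alpha>: "\<alpha> > 0" "B \<subseteq> smul (of_real \<alpha>) ` balanced_core smul V"
      using absorbed neighbourhood_balanced_core balanced_balanced_core by blast
    have "smul \<mu> ` B \<subseteq> V" if "norm \<mu> \<le> inverse \<alpha>" for \<mu>
    proof -
      have "norm (\<mu> * of_real \<alpha>) \<le> 1"
        using that \<alpha>(1) by (simp add: norm_mult field_simps)
      then show ?thesis
        using \<alpha>(2) by (auto simp: smul_smul balanced_core_def)
    qed
    then show "\<exists>\<alpha>::real. \<alpha> > 0 \<and> (\<forall>\<mu>. norm \<mu> \<le> \<alpha> \<longrightarrow> smul \<mu> ` B \<subseteq> V)"
      using \<alpha>(1) positive_imp_inverse_positive by blast
  qed
qed

end

theorem mainTheorem3:
  fixes rsmul :: "real \<Rightarrow> 'a::{ordered_comm_monoid_add, topological_comm_monoid_add} \<Rightarrow> 'a"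
    and csmul :: "complex \<Rightarrow> 'b::{ordered_comm_monoid_add, topological_comm_monoid_add} \<Rightarrow> 'b"
    and A :: "'a set" and B :: "'b set"
  shows "(topological_evs rsmul \<longrightarrow>
           (evs_bounded rsmul A \<longleftrightarrow>
             (\<forall>U. neighbourhood 0 U \<and> balanced rsmul U \<longrightarrow>
               (\<exists>\<alpha>::real. \<alpha> > 0 \<and> A \<subseteq> rsmul \<alpha> ` U)))) \<and>
         (topological_evs csmul \<longrightarrow>
           (evs_bounded csmul B \<longleftrightarrow>
             (\<forall>U. neighbourhood 0 U \<and> balanced csmul U \<longrightarrow>
               (\<exists>\<alpha>::real. \<alpha> > 0 \<and> B \<subseteq> csmul (complex_of_real \<alpha>) ` U))))"
  using topological_evs.evs_bounded_iff_absorbed[of rsmul A]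
    topological_evs.evs_bounded_iff_absorbed[of csmul B]
  by simp

end
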